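(* Let $X$ and $Y$ be Tychonoff spaces. If $\phi:\Gamma(C_{+}(X))\rightarrow\Gamma(C_{+}(Y))$ is a graph isomorphism, then for any vertices $f,g$ of $\Gamma(C_{+}(X))$, $Z(f)\subseteq Z(g)$ if and only if $Z(\phi(f))\subseteq Z(\phi(g))$.
   Context: For a Tychonoff space $X$, $C_{+}(X)$ is the semiring of non-negative real-valued continuous functions on $X$ with pointwise operations. For $f\in C_{+}(X)$, $Z(f)=\{x\in X: f(x)=0\}$, and $\mathcal{N}'(X)$ is the set of non-units of $C_{+}(X)$ (functions with $Z(f)\neq\emptyset$). The zero-set intersection graph $\Gamma(C_{+}(X))$ has vertex set $\mathcal{N}'(X)$, with distinct vertices $f,g$ adjacent iff $Z(f)\cap Z(g)\neq\emptyset$. A graph isomorphism is a bijection between vertex sets such that two vertices are adjacent iff their images are adjacent. *)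

theory Defs
  imports "HOL-Analysis.Analysis" "HOL-Algebra.Ring"
begin

definition tychonoff_space :: "'a topology \<Rightarrow> bool" where
  "tychonoff_space X \<longleftrightarrow> completely_regular_space X \<and> Hausdorff_space X"

(* The functions are taken extensional on the space: an element of the carrier is
   determined by its values on topspace X, so that equality in the carrier is
   equality of functions on the space. *)
definition C_plus :: "'a topology \<Rightarrow> ('a \<Rightarrow> real) ring" where
  "C_plus X =
    \<lparr>carrier = {f \<in> extensional (topspace X).
                 continuous_map X euclideanreal f \<and> (\<forall>x\<in>topspace X. 0 \<le> f x)},
     mult = (\<lambda>f g. \<lambda>x\<in>topspace X. f x * g x),
     one = (\<lambda>x\<in>topspace X. 1),
     zero = (\<lambda>x\<in>topspace X. 0),
     add = (\<lambda>f g. \<lambda>x\<in>topspace X. f x + g x)\<rparr>"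

definition zero_set :: "'a topology \<Rightarrow> ('a \<Rightarrow> real) \<Rightarrow> 'a set" where
  "zero_set X f = {x \<in> topspace X. f x = 0}"

definition nonunits :: "'a topology \<Rightarrow> ('a \<Rightarrow> real) set" where
  "nonunits X = carrier (C_plus X) - Units (C_plus X)"

record 'v graph =
  verts :: "'v set"
  adj :: "'v \<Rightarrow> 'v \<Rightarrow> bool"

definition graph_iso :: "'v graph \<Rightarrow> 'w graph \<Rightarrow> ('v \<Rightarrow> 'w) \<Rightarrow> bool" where
  "graph_iso G H \<phi> \<longleftrightarrow> bij_betw \<phi> (verts G) (verts H) \<and>
     (\<forall>u\<in>verts G. \<forall>v\<in>verts G. adj G u v \<longleftrightarrow> adj H (\<phi> u) (\<phi> v))"

definition zero_set_graph :: "'a topology \<Rightarrow> ('a \<Rightarrow> real) graph" where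
  "zero_set_graph X =
    \<lparr>verts = nonunits X,
     adj = (\<lambda>f g. f \<in> nonunits X \<and> g \<in> nonunits X \<and> f \<noteq> g \<and>
                  zero_set X f \<inter> zero_set X g \<noteq> {})\<rparr>"

lemma semiring_C_plus: "semiring (C_plus X)"
proof -
  have [simp]: "continuous_map X euclideanreal (restrict f (topspace X))
          \<longleftrightarrow> continuous_map X euclideanreal f" for f :: "'a \<Rightarrow> real"
    by (rule iffI; erule continuous_map_eq) auto
  show ?thesis
    unfolding C_plus_def
    by unfold_locales
       (auto simp: fun_eq_iff restrict_def extensional_def algebra_simps Units_def
             simp flip: restrict_def
             intro!: continuous_map_real_mult continuous_map_add)
qed

lemma nonunits_iff_zero_set:
  "nonunits X = {f \<in> carrier (C_plus X). zero_set X f \<noteq> {}}"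
proof -
  have "f \<in> Units (C_plus X) \<longleftrightarrow> zero_set X f = {}" if f: "f \<in> carrier (C_plus X)" for f
  proof
    assume "f \<in> Units (C_plus X)"
    then obtain g where "(\<lambda>x\<in>topspace X. g x * f x) = (\<lambda>x\<in>topspace X. 1)"
      by (auto simp: Units_def C_plus_def)
    then have "g x * f x = 1" if "x \<in> topspace X" for x
      using that by (auto simp: fun_eq_iff split: if_splits dest: spec[of _ x])
    then show "zero_set X f = {}" by (force simp: zero_set_def)
  next
    assume Z: "zero_set X f = {}"
    define g where "g = (\<lambda>x\<in>topspace X. inverse (f x))"
    have "continuous_map X euclideanreal (\<lambda>x. inverse (f x))"
      using f Z by (intro continuous_map_real_inverse) (auto simp: C_plus_def zero_set_def)
    then have "continuous_map X euclideanreal g"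
      by (rule continuous_map_eq) (simp add: g_def)
    then have "g \<in> carrier (C_plus X)"
      using f by (auto simp: C_plus_def g_def)
    moreover have "g \<otimes>\<^bsub>C_plus X\<^esub> f = \<one>\<^bsub>C_plus X\<^esub>" "f \<otimes>\<^bsub>C_plus X\<^esub> g = \<one>\<^bsub>C_plus X\<^esub>"
      using Z by (auto simp: C_plus_def g_def zero_set_def fun_eq_iff)
    ultimately show "f \<in> Units (C_plus X)"
      using f unfolding Units_def by blast
  qed
  then show ?thesis by (auto simp: nonunits_def)
qed

end

theory Submission
  imports Defs
begin

text \<open>For vertices \<open>u\<close> and \<open>v\<close>, ``equal or adjacent'' means that their zero sets meet, because the
  zero set of a vertex is nonempty. By complete regularity, inclusion of zero sets can be read off
  this relation: \<open>Z(f) \<subseteq> Z(g)\<close> iff every vertex whose zero set meets \<open>Z(f)\<close> has a zero set that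
  meets \<open>Z(g)\<close>. A graph isomorphism preserves this characterization.\<close>

text \<open>Adjacency excludes loops, so the case \<open>u = v\<close> is listed separately; there
  the intersection is nonempty because \<open>u\<close> is a non-unit.\<close>

lemma zero_sets_meet_iff:
  assumes "u \<in> verts (zero_set_graph X)" "v \<in> verts (zero_set_graph X)"
  shows "zero_set X u \<inter> zero_set X v \<noteq> {} \<longleftrightarrow> u = v \<or> adj (zero_set_graph X) u v"
  using assms by (auto simp: zero_set_graph_def nonunits_iff_zero_set)

lemma closedin_zero_set:
  assumes "continuous_map X euclideanreal f"
  shows "closedin X (zero_set X f)"
  using closedin_continuous_map_preimage[OF assms, of "{0}"] by (simp add: zero_set_def)

text \<open>Complete regularity gives a function that vanishes at \<open>x\<close> and equals 1 on
  \<open>S\<close>; its zero at \<open>x\<close> makes it a non-unit, hence a vertex.\<close>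

lemma vertex_separating_point_from_closedin:
  assumes X: "completely_regular_space X" and S: "closedin X S" and x: "x \<in> topspace X - S"
  obtains h where "h \<in> verts (zero_set_graph X)" "x \<in> zero_set X h" "zero_set X h \<inter> S = {}"
proof -
  obtain k where k: "continuous_map X (top_of_set {0..1::real}) k" "k x = 0" "k ` S \<subseteq> {1}"
    using X S x unfolding completely_regular_space_def by metis
  \<comment> \<open>The carrier holds only extensional functions, while \<open>k\<close> is
    arbitrary off the space.\<close>
  define h where "h = restrict k (topspace X)"
  have "continuous_map X euclideanreal k" and nonneg: "\<forall>y\<in>topspace X. 0 \<le> k y"
    using k(1) by (auto simp: continuous_map_in_subtopology)
  then have "continuous_map X euclideanreal h"
    by (elim continuous_map_eq) (simp add: h_def)
  then have "h \<in> carrier (C_plus X)"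
    using nonneg by (simp add: C_plus_def h_def)
  moreover have x_zero: "x \<in> zero_set X h"
    using k(2) x by (simp add: h_def zero_set_def)
  ultimately have "h \<in> verts (zero_set_graph X)"
    by (auto simp: zero_set_graph_def nonunits_iff_zero_set)
  moreover have "zero_set X h \<inter> S = {}"
    using k(3) by (force simp: h_def zero_set_def)
  ultimately show thesis
    using that x_zero by blast
qed

lemma zero_set_subset_iff:
  assumes X: "completely_regular_space X"
    and f: "f \<in> verts (zero_set_graph X)" and g: "g \<in> verts (zero_set_graph X)"
  shows "zero_set X f \<subseteq> zero_set X g \<longleftrightarrow>
    (\<forall>h\<in>verts (zero_set_graph X).
      h = f \<or> adj (zero_set_graph X) h f \<longrightarrow> h = g \<or> adj (zero_set_graph X) h g)"
    (is "_ \<longleftrightarrow> ?R")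
proof
  assume "zero_set X f \<subseteq> zero_set X g"
  then show ?R
    using zero_sets_meet_iff[OF _ f] zero_sets_meet_iff[OF _ g] by blast
next
  assume R: ?R
  show "zero_set X f \<subseteq> zero_set X g"
  proof (rule ccontr)
    assume "\<not> zero_set X f \<subseteq> zero_set X g"
    then obtain x where x: "x \<in> zero_set X f" "x \<notin> zero_set X g" by blast
    \<comment> \<open>Separating \<open>x\<close> from the closed set Z(g) yields a vertex
      \<open>h\<close> whose zero set meets Z(f) at \<open>x\<close> but misses Z(g), against
      \<open>R\<close>.\<close>
    have "closedin X (zero_set X g)"
      using g by (intro closedin_zero_set)
        (simp add: zero_set_graph_def nonunits_iff_zero_set C_plus_def)
    moreover have "x \<in> topspace X - zero_set X g"
      using x by (simp add: zero_set_def)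
    ultimately obtain h where "h \<in> verts (zero_set_graph X)" "x \<in> zero_set X h"
        "zero_set X h \<inter> zero_set X g = {}"
      by (rule vertex_separating_point_from_closedin[OF X])
    then show False
      using R x(1) zero_sets_meet_iff[OF _ f] zero_sets_meet_iff[OF _ g] by blast
  qed
qed

theorem theorem3p19:
  fixes X :: "'a topology" and Y :: "'b topology"
    and \<phi> :: "('a \<Rightarrow> real) \<Rightarrow> ('b \<Rightarrow> real)"
  assumes "tychonoff_space X" and "tychonoff_space Y"
    and "graph_iso (zero_set_graph X) (zero_set_graph Y) \<phi>"
    and "f \<in> verts (zero_set_graph X)" and "g \<in> verts (zero_set_graph X)"
  shows "zero_set X f \<subseteq> zero_set X g \<longleftrightarrow> zero_set Y (\<phi> f) \<subseteq> zero_set Y (\<phi> g)"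
proof -
  let ?G = "zero_set_graph X" and ?H = "zero_set_graph Y"
  have bij: "bij_betw \<phi> (verts ?G) (verts ?H)"
    and adj: "\<And>u v. u \<in> verts ?G \<Longrightarrow> v \<in> verts ?G \<Longrightarrow> adj ?G u v \<longleftrightarrow> adj ?H (\<phi> u) (\<phi> v)"
    using assms(3) by (auto simp: graph_iso_def)
  have image: "\<phi> ` verts ?G = verts ?H"
    using bij by (rule bij_betw_imp_surj_on)
  \<comment> \<open>The criterion mentions equality besides adjacency, so injectivity is used to
    carry it over.\<close>
  have eq: "u = v \<longleftrightarrow> \<phi> u = \<phi> v" if "u \<in> verts ?G" "v \<in> verts ?G" for u v
    using bij that by (auto simp: bij_betw_def dest: inj_onD)
  have "zero_set X f \<subseteq> zero_set X g \<longleftrightarrow>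
      (\<forall>h\<in>verts ?G. h = f \<or> adj ?G h f \<longrightarrow> h = g \<or> adj ?G h g)"
    using assms by (simp add: zero_set_subset_iff tychonoff_space_def)
  also have "\<dots> \<longleftrightarrow> (\<forall>h\<in>verts ?G. \<phi> h = \<phi> f \<or> adj ?H (\<phi> h) (\<phi> f)
      \<longrightarrow> \<phi> h = \<phi> g \<or> adj ?H (\<phi> h) (\<phi> g))"
    using assms(4,5) by (intro ball_cong refl) (simp add: adj eq)
  \<comment> \<open>By surjectivity, the images \<open>\<phi> h\<close> run through all test
    vertices of \<open>?H\<close>, which gives the full criterion on the side of
    \<open>Y\<close>.\<close>
  also have "\<dots> \<longleftrightarrow> (\<forall>h\<in>verts ?H. h = \<phi> f \<or> adj ?H h (\<phi> f)
      \<longrightarrow> h = \<phi> g \<or> adj ?H h (\<phi> g))"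
    by (simp flip: image)
  also have "\<dots> \<longleftrightarrow> zero_set Y (\<phi> f) \<subseteq> zero_set Y (\<phi> g)"
    using assms image by (subst zero_set_subset_iff) (auto simp: tychonoff_space_def)
  finally show ?thesis .
qed

end
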